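(* Let $p$ be a prime, $n\ge1$ an integer, $q=p^n$, $\theta$ the Frobenius automorphism $a\mapsto a^p$ of $\mathbb{F}_q$, and $R=\mathbb{F}_q[t;\theta]$, with $\theta$ extended to $R$ by $\theta(t)=t$. Let $G_0(t)=t^{(p-1)n}-1$ and $G(t)=t^{(p-1)n+1}-t$. Let $g(t)\in R$ be a $W$-polynomial of degree $r\ge 1$, let $h(t)\in R$ be a monic polynomial such that $G(t)=h(t)g(t)$, and let $C$ be the cyclic $(G(t),\theta,0)$-code defined by the $R$-module $Rg(t)/RG(t)$. (a) There exists $1\le l\le n$ such that $\theta^l(g(t))=g(t)$, and we then have $G(t)=h(t)g(t)=g(t)\theta^{l-1}(h(t))$. (b) With $l$ as in (a), the matrix whose rows are $T_G^i(\theta^{l-1}(\underline{h}))$ for $0\le i\le (p-1)n$ is a control matrix of the code $C$. (c) Suppose that $g(0)\neq 0$. Then there exists $h'(t)\in R$ such that $G_0(t)=h'(t)g(t)=g(t)h'(t)$, and the matrix whose rows are $T_{G_0}^i(\underline{h'})$ for $0\le i\le (p-1)n-1$ is a control matrix of the code corresponding to the cyclic module $Rg(t)/RG_0(t)$.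
   Context: $R=\mathbb{F}_q[t;\theta]$ consists of polynomials $\sum a_it^i$ with coefficients $a_i\in\mathbb{F}_q$ written on the left, with usual addition and multiplication determined by $ta=\theta(a)t$ for $a\in\mathbb{F}_q$. The extension of $\theta$ to $R$ is $\theta(\sum a_it^i)=\sum\theta(a_i)t^i$; $g(0)$ is the constant term of $g$. A monic polynomial $g(t)\in R$ of degree $r$ is a Wedderburn polynomial ($W$-polynomial) if there exist $a_1,\dots,a_r\in\mathbb{F}_q$ with $Rg(t)=\bigcap_{i=1}^{r}R(t-a_i)$. For a monic $F(t)=\sum_{i=0}^{N}a_it^i\in R$ of degree $N>0$, the companion matrix $C_F\in M_N(\mathbb{F}_q)$ has rows $e_2,e_3,\dots,e_N$ (standard basis row vectors) and last row $(-a_0,\dots,-a_{N-1})$, and $T_F:\mathbb{F}_q^N\to\mathbb{F}_q^N$ is $T_F(x_1,\dots,x_N)=(\theta(x_1),\dots,\theta(x_N))C_F$. For $u(t)=\sum_{i=0}^{N-1}u_it^i$ of degree $<N$, $\underline{u}=(u_0,\dots,u_{N-1})\in\mathbb{F}_q^N$, where $N=\deg G=(p-1)n+1$ in (b) and $N=\deg G_0=(p-1)n$ in (c); $\theta$ acts componentwise on $\mathbb{F}_q^N$. Every class in the left $R$-module $R/RF$ has a unique representative $\sum_{i=0}^{N-1}c_it^i$. For a monic $g$ with $F\in Rg$, the cyclic $(F,\theta,0)$-code corresponding to $Rg/RF$ is the set of coordinate vectors $(c_0,\dots,c_{N-1})\in\mathbb{F}_q^N$, in the basis $1,t,\dots,t^{N-1}$,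 of the elements of $Rg/RF\subseteq R/RF$. A matrix $H$ is a control matrix of a left linear code $C\subseteq\mathbb{F}_q^N$ if $C=\{c\in\mathbb{F}_q^N: cH=0\}$. *)

theory Defs
  imports
    "HOL-Computational_Algebra.Polynomial"
    "HOL-Library.Set_Algebras"
    "HOL-Library.Cardinality"
    "Jordan_Normal_Form.Matrix"
begin

text \<open>
  The skew polynomial ring \<open>R = K[t;\<theta>]\<close> (coefficients on the left, \<open>t a = \<theta>(a) t\<close>) has the same
  underlying additive group as \<open>K[t]\<close>. Its elements are therefore represented by the type
  \<^typ>\<open>'a poly\<close>, whose coefficients, degree, monomials and addition are used unchanged. The library
  product on \<^typ>\<open>'a poly\<close> is the commutative one and is not the product of \<open>R\<close>; the latter is
  \<open>skew_mult \<theta>\<close>, the biadditive extension of \<open>(a t\<^sup>i) (b t\<^sup>j) = a \<theta>\<^sup>i(b) t\<^sup>i\<^sup>+\<^sup>j\<close>.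
\<close>

definition skew_mult :: "('a \<Rightarrow> 'a) \<Rightarrow> 'a::field poly \<Rightarrow> 'a poly \<Rightarrow> 'a poly" where
  "skew_mult \<theta> f g =
     (\<Sum>i\<le>degree f. \<Sum>j\<le>degree g. monom (coeff f i * (\<theta> ^^ i) (coeff g j)) (i + j))"

text \<open>The principal left ideal \<open>R g\<close>.\<close>

definition left_ideal :: "('a \<Rightarrow> 'a) \<Rightarrow> 'a::field poly \<Rightarrow> 'a poly set" where
  "left_ideal \<theta> g = range (\<lambda>f. skew_mult \<theta> f g)"

definition W_polynomial :: "('a \<Rightarrow> 'a) \<Rightarrow> 'a::field poly \<Rightarrow> bool" where
  "W_polynomial \<theta> g \<longleftrightarrow> lead_coeff g = 1 \<and>
     (\<exists>a :: nat \<Rightarrow> 'a. left_ideal \<theta> g =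
        (\<Inter>i\<in>{1..degree g}. left_ideal \<theta> (monom 1 1 - monom (a i) 0)))"

text \<open>The coordinate row vector of \<open>u\<close> (meant for \<open>deg u < N\<close>), and the polynomial of a vector.\<close>

definition coord_vec :: "nat \<Rightarrow> 'a::zero poly \<Rightarrow> 'a vec" where
  "coord_vec N u = vec N (coeff u)"

definition poly_of_coords :: "'a::comm_monoid_add vec \<Rightarrow> 'a poly" where
  "poly_of_coords c = (\<Sum>i<dim_vec c. monom (c $ i) i)"

text \<open>Vectors of the matrix library act as row vectors here; this is the product \<open>x A\<close>.\<close>

definition row_vec_mult :: "'a::semiring_0 vec \<Rightarrow> 'a mat \<Rightarrow> 'a vec" where
  "row_vec_mult x A = vec (dim_col A) (\<lambda>j. x \<bullet> col A j)"

definition companion_mat :: "'a::field poly \<Rightarrow> 'a mat" where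
  "companion_mat F = mat (degree F) (degree F)
     (\<lambda>(i, j). if i = degree F - 1 then - coeff F j else if j = i + 1 then 1 else 0)"

definition T_map :: "('a \<Rightarrow> 'a) \<Rightarrow> 'a::field poly \<Rightarrow> 'a vec \<Rightarrow> 'a vec" where
  "T_map \<theta> F x = row_vec_mult (map_vec \<theta> x) (companion_mat F)"

definition T_orbit_mat :: "('a \<Rightarrow> 'a) \<Rightarrow> 'a::field poly \<Rightarrow> 'a vec \<Rightarrow> nat \<Rightarrow> 'a mat" where
  "T_orbit_mat \<theta> F v m = mat_of_rows (degree F) (map (\<lambda>i. (T_map \<theta> F ^^ i) v) [0..<m])"

text \<open>
  The left module \<open>R / R F\<close> and its submodule \<open>R g / R F\<close> consist of additive cosets of \<open>R F\<close>;
  the code collects the coordinates \<open>c\<close> whose class lies in \<open>R g / R F\<close>. Meant for monic \<open>g\<close>, \<open>F\<close>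
  with \<open>F \<in> R g\<close>.
\<close>

definition cyclic_code :: "('a \<Rightarrow> 'a) \<Rightarrow> 'a::field poly \<Rightarrow> 'a poly \<Rightarrow> 'a vec set" where
  "cyclic_code \<theta> g F = {c \<in> carrier_vec (degree F).
     poly_of_coords c +o left_ideal \<theta> F \<in> (\<lambda>f. f +o left_ideal \<theta> F) ` left_ideal \<theta> g}"

definition is_control_mat :: "nat \<Rightarrow> 'a::field mat \<Rightarrow> 'a vec set \<Rightarrow> bool" where
  "is_control_mat N H C \<longleftrightarrow> dim_row H = N \<and>
     C = {c \<in> carrier_vec N. row_vec_mult c H = 0\<^sub>v (dim_col H)}"

subsection \<open>The product satisfies the ring laws\<close>

lemma skew_mult_bounds:
  assumes "degree f \<le> m" "degree g \<le> n" "\<theta> 0 = 0"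
  shows "skew_mult \<theta> f g =
    (\<Sum>i\<le>m. \<Sum>j\<le>n. monom (coeff f i * (\<theta> ^^ i) (coeff g j)) (i + j))"
proof -
  have z: "(\<theta> ^^ i) 0 = 0" for i
    using assms(3) by (induction i) auto
  have "(\<Sum>j\<le>degree g. monom (coeff f i * (\<theta> ^^ i) (coeff g j)) (i + j)) =
      (\<Sum>j\<le>n. monom (coeff f i * (\<theta> ^^ i) (coeff g j)) (i + j))" for i
    using assms(2) by (intro sum.mono_neutral_left) (auto simp: coeff_eq_0 z)
  then have "skew_mult \<theta> f g =
      (\<Sum>i\<le>degree f. \<Sum>j\<le>n. monom (coeff f i * (\<theta> ^^ i) (coeff g j)) (i + j))"
    by (simp add: skew_mult_def)
  also have "\<dots> = (\<Sum>i\<le>m. \<Sum>j\<le>n. monom (coeff f i * (\<theta> ^^ i) (coeff g j)) (i + j))"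
    using assms(1) by (intro sum.mono_neutral_left) (auto simp: coeff_eq_0)
  finally show ?thesis .
qed

lemma skew_mult_monom:
  assumes "\<theta> 0 = 0"
  shows "skew_mult \<theta> (monom a i) (monom b j) = monom (a * (\<theta> ^^ i) b) (i + j)"
proof -
  have z: "(\<theta> ^^ i) 0 = 0"
    using assms by (induction i) auto
  have "skew_mult \<theta> (monom a i) (monom b j) =
    (\<Sum>i'\<le>i. \<Sum>j'\<le>j. monom (coeff (monom a i) i' * (\<theta> ^^ i') (coeff (monom b j) j')) (i' + j'))"
    by (rule skew_mult_bounds) (auto simp: degree_monom_le assms)
  also have "\<dots> = (\<Sum>i'\<le>i. if i' = i then
      (\<Sum>j'\<le>j. if j' = j then monom (a * (\<theta> ^^ i) b) (i + j) else 0) else 0)"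
  proof (intro sum.cong refl)
    fix i' :: nat
    have "(\<Sum>j'\<le>j. monom (a * (\<theta> ^^ i) (coeff (monom b j) j')) (i + j')) =
        (\<Sum>j'\<le>j. if j' = j then monom (a * (\<theta> ^^ i) b) (i + j) else 0)"
      by (intro sum.cong refl) (simp add: z)
    then show "(\<Sum>j'\<le>j. monom (coeff (monom a i) i' * (\<theta> ^^ i') (coeff (monom b j) j')) (i' + j')) =
        (if i' = i then (\<Sum>j'\<le>j. if j' = j then monom (a * (\<theta> ^^ i) b) (i + j) else 0) else 0)"
      by (cases "i' = i") simp_all
  qed
  finally show ?thesis by simp
qed

lemma skew_mult_add_left:
  assumes "\<theta> 0 = 0"
  shows "skew_mult \<theta> (f + f') g = skew_mult \<theta> f g + skew_mult \<theta> f' g"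
proof -
  define m where "m = max (degree f) (degree f')"
  have "degree (f + f') \<le> m" "degree f \<le> m" "degree f' \<le> m"
    by (auto simp: m_def degree_add_le_max)
  then show ?thesis
    by (simp add: skew_mult_bounds[where m = m and n = "degree g"] assms
        distrib_right add_monom[symmetric] sum.distrib)
qed

lemma skew_mult_add_right:
  assumes "\<theta> 0 = 0" "\<And>x y. \<theta> (x + y) = \<theta> x + \<theta> y"
  shows "skew_mult \<theta> f (g + g') = skew_mult \<theta> f g + skew_mult \<theta> f g'"
proof -
  define n where "n = max (degree g) (degree g')"
  have a: "(\<theta> ^^ i) (x + y) = (\<theta> ^^ i) x + (\<theta> ^^ i) y" for i x y
    by (induction i) (auto simp: assms(2))
  have "degree (g + g') \<le> n" "degree g \<le> n" "degree g' \<le> n"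
    by (auto simp: n_def degree_add_le_max)
  then show ?thesis
    by (simp add: skew_mult_bounds[where n = n and m = "degree f"] assms(1) a
        distrib_left add_monom[symmetric] sum.distrib)
qed

lemma skew_mult_one:
  assumes "\<theta> 0 = 0" "\<theta> 1 = 1"
  shows "skew_mult \<theta> 1 f = f" "skew_mult \<theta> f 1 = f"
proof -
  have o: "(\<theta> ^^ i) 1 = 1" for i
    by (induction i) (auto simp: assms(2))
  show "skew_mult \<theta> 1 f = f" "skew_mult \<theta> f 1 = f"
    by (simp_all add: skew_mult_def o poly_as_sum_of_monoms)
qed

lemma skew_mult_assoc:
  assumes "\<theta> 0 = 0" "\<And>x y. \<theta> (x + y) = \<theta> x + \<theta> y" "\<And>x y. \<theta> (x * y) = \<theta> x * \<theta> y"
  shows "skew_mult \<theta> (skew_mult \<theta> f g) h = skew_mult \<theta> f (skew_mult \<theta> g h)"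
proof -
  have z: "(\<theta> ^^ i) 0 = 0" for i
    using assms(1) by (induction i) auto
  have z0: "skew_mult \<theta> 0 u = 0" "skew_mult \<theta> u 0 = 0" for u
    by (simp_all add: skew_mult_def z)
  have l: "skew_mult \<theta> (sum F A) u = (\<Sum>x\<in>A. skew_mult \<theta> (F x) u)"
    if "finite A" for F u and A :: "nat set"
    using that by (induction A rule: finite_induct)
      (simp_all add: skew_mult_add_left assms z0)
  have r: "skew_mult \<theta> u (sum F A) = (\<Sum>x\<in>A. skew_mult \<theta> u (F x))"
    if "finite A" for F u and A :: "nat set"
    using that by (induction A rule: finite_induct)
      (simp_all add: skew_mult_add_right assms z0)
  have m: "(\<theta> ^^ i) (x * y) = (\<theta> ^^ i) x * (\<theta> ^^ i) y" for i x y
    by (induction i) (auto simp: assms(3))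
  have "skew_mult \<theta> (skew_mult \<theta> (\<Sum>i\<le>degree f. monom (coeff f i) i)
          (\<Sum>j\<le>degree g. monom (coeff g j) j)) (\<Sum>k\<le>degree h. monom (coeff h k) k) =
      skew_mult \<theta> (\<Sum>i\<le>degree f. monom (coeff f i) i) (skew_mult \<theta>
          (\<Sum>j\<le>degree g. monom (coeff g j) j) (\<Sum>k\<le>degree h. monom (coeff h k) k))"
    by (simp add: l r skew_mult_monom assms(1) m funpow_add mult.assoc add.assoc)
  then show ?thesis
    by (simp add: poly_as_sum_of_monoms)
qed

end

theory Submission
  imports Defs
begin

text \<open>
  Left multiplication by \<open>t\<close> on \<open>R / R F\<close> is \<open>T\<^sub>F\<close> in coordinates, so \<open>c H\<close>, where the rows of \<open>H\<close> are the
  iterates \<open>T\<^sub>F\<^sup>i v\<close>, is the coordinate vector of \<open>c(t) v(t)\<close> modulo \<open>R F\<close>. If \<open>F = g h'\<close>, then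
  \<open>c h' \<in> R F = R g h'\<close> exactly if \<open>c \<in> R g\<close>, because \<open>R\<close> is a domain. It remains to turn left
  cofactors of \<open>g\<close> into right ones: since \<open>\<theta>\<^sup>n = id\<close>, one has \<open>G f = \<theta>(f) G\<close> and \<open>G\<^sub>0\<close> is central.
  With \<open>\<theta>\<^sup>l(g) = g\<close> and \<open>\<theta>(G) = G\<close> this gives \<open>G \<theta>\<^sup>l\<^sup>-\<^sup>1(g) = g G = g \<theta>\<^sup>l\<^sup>-\<^sup>1(h) \<theta>\<^sup>l\<^sup>-\<^sup>1(g)\<close>, and
  \<open>\<theta>\<^sup>l\<^sup>-\<^sup>1(g)\<close> can be cancelled.
\<close>

section \<open>Polynomials and their coordinate vectors\<close>

lemma coeff_poly_of_coords: "coeff (poly_of_coords c) k = (if k < dim_vec c then c $ k else 0)"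
  by (simp add: poly_of_coords_def coeff_sum)

lemma poly_of_coords_coord_vec: "degree u < N \<Longrightarrow> poly_of_coords (coord_vec N u) = u"
  by (auto intro!: poly_eqI simp: coeff_poly_of_coords coord_vec_def coeff_eq_0)

lemma poly_of_coords_eq_0_iff: "poly_of_coords c = 0 \<longleftrightarrow> c = 0\<^sub>v (dim_vec c)"
  by (auto simp: poly_eq_iff vec_eq_iff coeff_poly_of_coords)

section \<open>Skew polynomials over a field with an endomorphism\<close>

locale field_endomorphism =
  fixes \<theta> :: "'a::field \<Rightarrow> 'a"
  assumes endo_add: "\<theta> (x + y) = \<theta> x + \<theta> y"
    and endo_mult: "\<theta> (x * y) = \<theta> x * \<theta> y"
    and endo_1: "\<theta> 1 = 1"
begin

abbreviation skew_mult_syntax (infixl "\<star>" 70) where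
  "f \<star> g \<equiv> skew_mult \<theta> f g"

lemma endo_0: "\<theta> 0 = 0"
  using endo_add[of 0 0] by (metis add_0 add_cancel_right_right)

text \<open>A nonzero element is a unit, and units go to units. This injectivity is what later makes
  the skew polynomial ring a domain.\<close>

lemma endo_eq_0_iff: "\<theta> x = 0 \<longleftrightarrow> x = 0"
proof
  assume "\<theta> x = 0"
  show "x = 0"
  proof (rule ccontr)
    assume "x \<noteq> 0"
    then have "\<theta> x * \<theta> (inverse x) = 1"
      by (simp flip: endo_mult add: endo_1)
    with \<open>\<theta> x = 0\<close> show False by simp
  qed
qed (simp add: endo_0)

lemma endo_minus: "\<theta> (x - y) = \<theta> x - \<theta> y"
  using endo_add[of "x - y" y] by simp

lemma endo_sum: "\<theta> (sum f A) = (\<Sum>x\<in>A. \<theta> (f x))"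
  by (induction A rule: infinite_finite_induct) (simp_all add: endo_0 endo_add)

lemma funpow_eq_0_iff: "(\<theta> ^^ k) x = 0 \<longleftrightarrow> x = 0"
  by (induction k) (simp_all add: endo_eq_0_iff)

text \<open>Products twist coefficients by iterates of \<open>\<theta>\<close>; this makes the rules
  for 0, 1 and differences available for each iterate.\<close>

lemma field_endomorphism_funpow: "field_endomorphism (\<theta> ^^ k)"
proof
  show "(\<theta> ^^ k) (x + y) = (\<theta> ^^ k) x + (\<theta> ^^ k) y" for x y
    by (induction k) (simp_all add: endo_add)
  show "(\<theta> ^^ k) (x * y) = (\<theta> ^^ k) x * (\<theta> ^^ k) y" for x y
    by (induction k) (simp_all add: endo_mult)
  show "(\<theta> ^^ k) 1 = 1"
    by (induction k) (simp_all add: endo_1)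
qed

lemma coeff_map_poly_funpow: "coeff ((map_poly \<theta> ^^ k) f) i = (\<theta> ^^ k) (coeff f i)"
  by (induction k) (simp_all add: coeff_map_poly endo_0)

lemma coeff_skew_mult: "coeff (f \<star> g) k = (\<Sum>i\<le>k. coeff f i * (\<theta> ^^ i) (coeff g (k - i)))"
proof -
  \<comment> \<open>Both summation ranges are padded to reach \<open>k\<close>, so that the whole
    diagonal \<open>i + j = k\<close> lies inside them.\<close>
  define m n where "m = max (degree f) k" and "n = max (degree g) k"
  have "coeff (f \<star> g) k =
      (\<Sum>i\<le>m. \<Sum>j\<le>n. if i + j = k then coeff f i * (\<theta> ^^ i) (coeff g j) else 0)"
    by (subst skew_mult_bounds[where m = m and n = n])
      (auto simp: m_def n_def endo_0 coeff_sum intro!: sum.cong)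
  also have "\<dots> = (\<Sum>i\<le>m. if i \<le> k then coeff f i * (\<theta> ^^ i) (coeff g (k - i)) else 0)"
  proof (intro sum.cong refl)
    fix i
    \<comment> \<open>The inner test \<open>i \<le> k\<close> guards against truncated subtraction:
      for \<open>i > k\<close> the index \<open>j = 0\<close> would otherwise be picked up.\<close>
    have "(\<Sum>j\<le>n. if i + j = k then coeff f i * (\<theta> ^^ i) (coeff g j) else 0) =
        (\<Sum>j\<le>n. if k - i = j then (if i \<le> k then coeff f i * (\<theta> ^^ i) (coeff g (k - i)) else 0) else 0)"
      by (intro sum.cong refl) auto
    then show "(\<Sum>j\<le>n. if i + j = k then coeff f i * (\<theta> ^^ i) (coeff g j) else 0) =
        (if i \<le> k then coeff f i * (\<theta> ^^ i) (coeff g (k - i)) else 0)"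
      by (simp add: n_def le_max_iff_disj)
  qed
  also have "\<dots> = (\<Sum>i\<le>k. coeff f i * (\<theta> ^^ i) (coeff g (k - i)))"
    by (intro sum.mono_neutral_cong_right) (auto simp: m_def)
  finally show ?thesis .
qed

lemma coeff_monom_skew_mult:
  "coeff (monom a k \<star> f) m = (if k \<le> m then a * (\<theta> ^^ k) (coeff f (m - k)) else 0)"
proof -
  have "coeff (monom a k \<star> f) m =
      (\<Sum>i\<le>m. if i = k then a * (\<theta> ^^ k) (coeff f (m - k)) else 0)"
    unfolding coeff_skew_mult by (intro sum.cong refl) simp
  then show ?thesis by simp
qed

lemma coeff_skew_mult_monom_1:
  "coeff (f \<star> monom 1 k) m = (if k \<le> m then coeff f (m - k) else 0)"
proof -
  interpret pow: field_endomorphism "\<theta> ^^ i" for i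
    by (rule field_endomorphism_funpow)
  have "coeff (f \<star> monom 1 k) m =
      (\<Sum>i\<le>m. if i = m - k then if k \<le> m then coeff f (m - k) else 0 else 0)"
    unfolding coeff_skew_mult by (intro sum.cong refl) (auto simp: pow.endo_0 pow.endo_1)
  then show ?thesis by simp
qed

text \<open>The rule \<open>t a = \<theta>(a) t\<close> carried from scalars to whole polynomials.
  The commutation rules for \<open>G\<close> and \<open>G\<^sub>0\<close> come from it.\<close>

lemma monom_1_skew_mult: "monom 1 k \<star> f = (map_poly \<theta> ^^ k) f \<star> monom 1 k"
  by (rule poly_eqI) (simp add: coeff_monom_skew_mult coeff_skew_mult_monom_1 coeff_map_poly_funpow)

text \<open>The coefficientwise extension is multiplicative because \<open>\<theta>\<close> commutes
  with its own iterates.\<close>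

lemma map_poly_skew_mult: "map_poly \<theta> (f \<star> g) = map_poly \<theta> f \<star> map_poly \<theta> g"
  by (rule poly_eqI)
    (simp add: coeff_map_poly endo_0 coeff_skew_mult endo_sum endo_mult funpow_swap1)

lemma map_poly_funpow_skew_mult:
  "(map_poly \<theta> ^^ k) (f \<star> g) = (map_poly \<theta> ^^ k) f \<star> (map_poly \<theta> ^^ k) g"
  by (induction k) (simp_all add: map_poly_skew_mult)

lemmas skew_add_left = skew_mult_add_left[of \<theta>, OF endo_0]
  and skew_add_right = skew_mult_add_right[of \<theta>, OF endo_0 endo_add]
  and skew_assoc = skew_mult_assoc[of \<theta>, OF endo_0 endo_add endo_mult]
  and skew_one = skew_mult_one[of \<theta>, OF endo_0 endo_1]

lemma skew_minus_left: "(f - f') \<star> g = f \<star> g - f' \<star> g"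
  using skew_add_left[of "f - f'" f' g] by simp

lemma skew_minus_right: "f \<star> (g - g') = f \<star> g - f \<star> g'"
  using skew_add_right[of f "g - g'" g'] by simp

lemma skew_zero: "0 \<star> f = 0" "f \<star> 0 = 0"
  using skew_minus_left[of 0 0 f] skew_minus_right[of f 0 0] by simp_all

lemma skew_sum_left: "sum F A \<star> g = (\<Sum>x\<in>A. F x \<star> g)"
  by (induction A rule: infinite_finite_induct) (simp_all add: skew_zero skew_add_left)

text \<open>Only \<open>i = degree f\<close> contributes: for smaller \<open>i\<close> the
  coefficient of \<open>g\<close> vanishes, for larger \<open>i\<close> that of \<open>f\<close>. By
  injectivity of \<open>\<theta>\<close> the value is nonzero for nonzero factors, so there are no
  zero divisors.\<close>

lemma coeff_skew_mult_degree_add: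
  "coeff (f \<star> g) (degree f + degree g) = lead_coeff f * (\<theta> ^^ degree f) (lead_coeff g)"
proof -
  have "coeff (f \<star> g) (degree f + degree g) = (\<Sum>i\<le>degree f + degree g.
      if i = degree f then lead_coeff f * (\<theta> ^^ degree f) (lead_coeff g) else 0)"
    unfolding coeff_skew_mult
  proof (intro sum.cong refl)
    fix i
    have "i < degree f \<Longrightarrow> coeff g (degree f + degree g - i) = 0"
      by (rule coeff_eq_0) simp
    moreover have "i > degree f \<Longrightarrow> coeff f i = 0"
      by (rule coeff_eq_0)
    ultimately show "coeff f i * (\<theta> ^^ i) (coeff g (degree f + degree g - i)) =
        (if i = degree f then lead_coeff f * (\<theta> ^^ degree f) (lead_coeff g) else 0)"
      by (cases i "degree f" rule: linorder_cases) (simp_all add: funpow_eq_0_iff)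
  qed
  then show ?thesis by simp
qed

lemma skew_mult_eq_0_iff: "f \<star> g = 0 \<longleftrightarrow> f = 0 \<or> g = 0"
proof
  assume "f \<star> g = 0"
  then have "lead_coeff f * (\<theta> ^^ degree f) (lead_coeff g) = 0"
    by (simp flip: coeff_skew_mult_degree_add)
  then show "f = 0 \<or> g = 0"
    by (simp add: funpow_eq_0_iff)
qed (auto simp: skew_zero)

lemma skew_mult_cancel_right: "f \<star> g = f' \<star> g \<Longrightarrow> g \<noteq> 0 \<Longrightarrow> f = f'"
  using skew_mult_eq_0_iff[of "f - f'" g] by (simp add: skew_minus_left)

lemma skew_mult_cancel_left: "g \<star> f = g \<star> f' \<Longrightarrow> g \<noteq> 0 \<Longrightarrow> f = f'"
  using skew_mult_eq_0_iff[of g "f - f'"] by (simp add: skew_minus_right)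

lemma degree_skew_mult:
  assumes "f \<noteq> 0" "g \<noteq> 0"
  shows "degree (f \<star> g) = degree f + degree g"
proof (rule antisym)
  show "degree (f \<star> g) \<le> degree f + degree g"
  proof (rule degree_le, intro allI impI)
    fix k assume k: "degree f + degree g < k"
    have "coeff f i * (\<theta> ^^ i) (coeff g (k - i)) = 0" for i
    proof (cases "i \<le> degree f")
      case True
      with k have "coeff g (k - i) = 0" by (intro coeff_eq_0) simp
      then show ?thesis by (simp add: funpow_eq_0_iff)
    qed (simp add: coeff_eq_0)
    then show "coeff (f \<star> g) k = 0"
      by (simp only: coeff_skew_mult sum.neutral_const)
  qed
  show "degree f + degree g \<le> degree (f \<star> g)"
    using assms by (intro le_degree) (simp add: coeff_skew_mult_degree_add funpow_eq_0_iff)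
qed

section \<open>Left ideals and cyclic codes\<close>

lemma left_ideal_skew_mult: "f \<in> left_ideal \<theta> g \<Longrightarrow> u \<star> f \<in> left_ideal \<theta> g"
  by (auto simp: left_ideal_def skew_assoc[symmetric])

lemma left_ideal_add: "u \<in> left_ideal \<theta> g \<Longrightarrow> v \<in> left_ideal \<theta> g \<Longrightarrow> u + v \<in> left_ideal \<theta> g"
  by (auto simp: left_ideal_def skew_add_left[symmetric])

lemma left_ideal_minus: "u \<in> left_ideal \<theta> g \<Longrightarrow> v \<in> left_ideal \<theta> g \<Longrightarrow> u - v \<in> left_ideal \<theta> g"
  by (auto simp: left_ideal_def skew_minus_left[symmetric])

lemma left_ideal_zero: "0 \<in> left_ideal \<theta> g"
  unfolding left_ideal_def by (rule range_eqI[of _ _ 0]) (simp add: skew_zero)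

lemma left_ideal_sum: "(\<And>i. i \<in> A \<Longrightarrow> f i \<in> left_ideal \<theta> g) \<Longrightarrow> sum f A \<in> left_ideal \<theta> g"
  by (induction A rule: infinite_finite_induct) (auto simp: left_ideal_zero left_ideal_add)

text \<open>Degrees add, so a nonzero multiple of \<open>F\<close> has at least the degree of
  \<open>F\<close>. Hence a residue of smaller degree is zero as soon as its class is.\<close>

lemma left_ideal_degree_less: "f \<in> left_ideal \<theta> F \<Longrightarrow> degree f < degree F \<Longrightarrow> f = 0"
  unfolding left_ideal_def by (metis degree_skew_mult not_add_less2 rangeE skew_zero)

text \<open>As \<open>R F\<close> lies in \<open>R g\<close>, membership of a coset in
  \<open>R g / R F\<close> can be tested on any representative, which replaces cosets by right
  divisibility by \<open>g\<close>.\<close>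

lemma cyclic_code_eq:
  assumes "F \<in> left_ideal \<theta> g"
  shows "cyclic_code \<theta> g F = {c \<in> carrier_vec (degree F). poly_of_coords c \<in> left_ideal \<theta> g}"
proof -
  have sub: "left_ideal \<theta> F \<subseteq> left_ideal \<theta> g"
    using left_ideal_skew_mult[OF assms] by (auto simp: left_ideal_def[of _ F])
  have "u +o left_ideal \<theta> F \<in> (\<lambda>f. f +o left_ideal \<theta> F) ` left_ideal \<theta> g \<longleftrightarrow>
      u \<in> left_ideal \<theta> g" for u
  proof
    assume "u +o left_ideal \<theta> F \<in> (\<lambda>f. f +o left_ideal \<theta> F) ` left_ideal \<theta> g"
    then obtain f where f: "f \<in> left_ideal \<theta> g" "u +o left_ideal \<theta> F = f +o left_ideal \<theta> F"
      by blast
    have "u \<in> u +o left_ideal \<theta> F"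
      using left_ideal_zero[of F] by (auto simp: elt_set_plus_def)
    with f obtain w where "w \<in> left_ideal \<theta> F" "u = f + w"
      by (auto simp: elt_set_plus_def)
    with f sub show "u \<in> left_ideal \<theta> g"
      by (auto intro: left_ideal_add)
  qed blast
  then show ?thesis
    by (simp add: cyclic_code_def)
qed

section \<open>The map \<open>T_map\<close> and control matrices\<close>

lemma dim_T_map_funpow:
  "dim_vec v = degree F \<Longrightarrow> dim_vec ((T_map \<theta> F ^^ i) v) = degree F"
  by (cases i) (simp_all add: T_map_def row_vec_mult_def companion_mat_def)

text \<open>Multiplying by \<open>t\<close> shifts the twisted coordinates and may create a term of
  degree \<open>degree F\<close>. Subtracting the matching left multiple of the monic
  \<open>F\<close> removes it; the last row of the companion matrix performs this reduction.\<close>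

lemma poly_of_coords_T_map:
  assumes "lead_coeff F = 1" "degree F > 0" and x: "dim_vec x = degree F"
  shows "poly_of_coords (T_map \<theta> F x) =
    monom 1 1 \<star> poly_of_coords x - monom (\<theta> (x $ (degree F - 1))) 0 \<star> F"
proof (rule poly_eqI)
  fix j
  let ?N = "degree F" and ?y = "\<theta> (x $ (degree F - 1))"
  have "coeff (poly_of_coords (T_map \<theta> F x)) j = (if j = 0 then 0 else \<theta> (x $ (j - 1))) - ?y * coeff F j"
    if j: "j < ?N"
  proof -
    have "coeff (poly_of_coords (T_map \<theta> F x)) j =
        (\<Sum>i<?N. \<theta> (x $ i) * (if i = ?N - 1 then - coeff F j else if j = i + 1 then 1 else 0))"
      using j x by (simp add: coeff_poly_of_coords T_map_def row_vec_mult_def companion_mat_def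
          scalar_prod_def atLeast0LessThan)
    \<comment> \<open>The last row gives the reduction term and the superdiagonal gives the shift.
      Column 0 has no superdiagonal entry, whence the test \<open>j = 0\<close>.\<close>
    also have "\<dots> = (\<Sum>i<?N. (if i = ?N - 1 then - ?y * coeff F j else 0) +
        (if i = j - 1 then if j = 0 then 0 else \<theta> (x $ (j - 1)) else 0))"
      using j by (intro sum.cong refl) auto
    also have "\<dots> = (if j = 0 then 0 else \<theta> (x $ (j - 1))) - ?y * coeff F j"
      using j by (simp add: sum.distrib)
    finally show ?thesis .
  qed
  moreover have "coeff (poly_of_coords (T_map \<theta> F x)) j = 0" if "\<not> j < ?N"
    using that by (simp add: coeff_poly_of_coords T_map_def row_vec_mult_def companion_mat_def)
  moreover have "coeff F j = 0" if "j > ?N"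
    using that by (rule coeff_eq_0)
  \<comment> \<open>At \<open>j = ?N\<close> the shifted top coordinate cancels against the leading
    coefficient 1 of \<open>F\<close> times \<open>?y\<close>; beyond that all coefficients are
    0.\<close>
  ultimately show "coeff (poly_of_coords (T_map \<theta> F x)) j =
      coeff (monom 1 1 \<star> poly_of_coords x - monom ?y 0 \<star> F) j"
    using assms by (cases j ?N rule: linorder_cases)
      (auto simp: coeff_monom_skew_mult coeff_poly_of_coords endo_0)
qed

text \<open>Each application of \<open>T_map\<close> costs one multiple of \<open>F\<close>, and
  earlier errors stay in \<open>R F\<close> under left multiplication by \<open>t\<close>.\<close>

lemma poly_of_coords_T_map_funpow:
  assumes "lead_coeff F = 1" "degree F > 0" "dim_vec v = degree F"
  shows "poly_of_coords ((T_map \<theta> F ^^ i) v) - monom 1 i \<star> poly_of_coords v \<in> left_ideal \<theta> F"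
proof (induction i)
  case 0
  then show ?case
    by (simp add: monom_0 flip: one_pCons add: skew_one left_ideal_zero)
next
  case (Suc i)
  define w where "w = (T_map \<theta> F ^^ i) v"
  have eq: "monom 1 (Suc i) \<star> poly_of_coords v = monom 1 1 \<star> (monom 1 i \<star> poly_of_coords v)"
    by (simp add: skew_assoc[symmetric] skew_mult_monom endo_0 endo_1)
  have "poly_of_coords ((T_map \<theta> F ^^ Suc i) v) =
      monom 1 1 \<star> poly_of_coords w - monom (\<theta> (w $ (degree F - 1))) 0 \<star> F"
    using poly_of_coords_T_map[OF assms(1,2) dim_T_map_funpow[OF assms(3)]] by (simp add: w_def)
  then have "poly_of_coords ((T_map \<theta> F ^^ Suc i) v) - monom 1 (Suc i) \<star> poly_of_coords v =
      monom 1 1 \<star> (poly_of_coords w - monom 1 i \<star> poly_of_coords v) -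
      monom (\<theta> (w $ (degree F - 1))) 0 \<star> F"
    unfolding eq by (simp add: skew_minus_right)
  moreover have "monom (\<theta> (w $ (degree F - 1))) 0 \<star> F \<in> left_ideal \<theta> F"
    by (auto simp: left_ideal_def)
  ultimately show ?case
    using left_ideal_minus[OF left_ideal_skew_mult[OF Suc.IH, of "monom 1 1"]] by (simp add: w_def)
qed

lemma poly_of_coords_row_vec_mult_T_orbit_mat:
  assumes "lead_coeff F = 1" "degree F > 0" "dim_vec v = degree F" "dim_vec c = m"
  shows "poly_of_coords (row_vec_mult c (T_orbit_mat \<theta> F v m)) - poly_of_coords c \<star> poly_of_coords v
    \<in> left_ideal \<theta> F"
proof -
  let ?T = "\<lambda>i. poly_of_coords ((T_map \<theta> F ^^ i) v)"
  have "poly_of_coords (row_vec_mult c (T_orbit_mat \<theta> F v m)) = (\<Sum>i<m. monom (c $ i) 0 \<star> ?T i)"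
  proof (rule poly_eqI)
    fix j
    show "coeff (poly_of_coords (row_vec_mult c (T_orbit_mat \<theta> F v m))) j =
        coeff (\<Sum>i<m. monom (c $ i) 0 \<star> ?T i) j"
      using assms(3,4)
      by (auto simp: coeff_poly_of_coords row_vec_mult_def T_orbit_mat_def scalar_prod_def coeff_sum
          coeff_monom_skew_mult mat_of_rows_index dim_T_map_funpow atLeast0LessThan intro!: sum.cong)
  qed
  moreover have "poly_of_coords c \<star> poly_of_coords v =
      (\<Sum>i<m. monom (c $ i) 0 \<star> (monom 1 i \<star> poly_of_coords v))"
    by (simp add: poly_of_coords_def[of c] skew_sum_left assms(4) skew_assoc[symmetric]
        skew_mult_monom endo_0)
  ultimately have "poly_of_coords (row_vec_mult c (T_orbit_mat \<theta> F v m)) -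
      poly_of_coords c \<star> poly_of_coords v =
      (\<Sum>i<m. monom (c $ i) 0 \<star> (?T i - monom 1 i \<star> poly_of_coords v))"
    by (simp add: sum_subtractf skew_minus_right)
  then show ?thesis
    using poly_of_coords_T_map_funpow[OF assms(1-3)]
    by (auto intro!: left_ideal_sum left_ideal_skew_mult)
qed

text \<open>The two factorizations have different roles: \<open>h \<star> g\<close> places
  \<open>F\<close> in \<open>R g\<close>, so that the code is described by divisibility, while
  \<open>g \<star> h'\<close> lets \<open>h'\<close> be cancelled on the right.\<close>

theorem control_mat_cyclic_code:
  assumes "lead_coeff F = 1" "F = h \<star> g" "F = g \<star> h'" "degree g > 0"
  shows "is_control_mat (degree F) (T_orbit_mat \<theta> F (coord_vec (degree F) h') (degree F))
    (cyclic_code \<theta> g F)"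
proof -
  let ?N = "degree F" and ?H = "T_orbit_mat \<theta> F (coord_vec (degree F) h') (degree F)"
  have ne: "F \<noteq> 0" "g \<noteq> 0" "h' \<noteq> 0"
    using assms by (auto simp: skew_zero)
  \<comment> \<open>Positive degree of \<open>g\<close> keeps \<open>h'\<close> short enough for its
    coordinate vector to lose no coefficient.\<close>
  have deg: "degree h' < ?N"
    using assms(4) ne degree_skew_mult[of g h'] by (simp flip: assms(3))
  have "row_vec_mult c ?H = 0\<^sub>v (dim_col ?H) \<longleftrightarrow> poly_of_coords c \<in> left_ideal \<theta> g"
    if c: "c \<in> carrier_vec ?N" for c
  proof -
    let ?s = "poly_of_coords (row_vec_mult c ?H)"
    have dim: "dim_vec (row_vec_mult c ?H) = dim_col ?H" "dim_col ?H = ?N"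
      by (simp_all add: row_vec_mult_def T_orbit_mat_def)
    have diff: "?s - poly_of_coords c \<star> h' \<in> left_ideal \<theta> F"
      using poly_of_coords_row_vec_mult_T_orbit_mat[of F "coord_vec ?N h'" c ?N] deg c assms(1)
      by (simp add: poly_of_coords_coord_vec) (simp add: coord_vec_def)
    have "degree ?s < ?N"
      using deg by (intro degree_lessI) (auto simp: coeff_poly_of_coords dim)
    then have "?s = 0 \<longleftrightarrow> ?s \<in> left_ideal \<theta> F"
      using left_ideal_degree_less left_ideal_zero by metis
    also have "\<dots> \<longleftrightarrow> poly_of_coords c \<star> h' \<in> left_ideal \<theta> F"
      using left_ideal_minus[OF _ diff, of ?s] left_ideal_add[OF _ diff, of "poly_of_coords c \<star> h'"]
      by auto
    also have "\<dots> \<longleftrightarrow> poly_of_coords c \<in> left_ideal \<theta> g"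
    proof
      assume "poly_of_coords c \<star> h' \<in> left_ideal \<theta> F"
      then obtain a where "poly_of_coords c \<star> h' = a \<star> g \<star> h'"
        by (auto simp: left_ideal_def skew_assoc simp flip: assms(3))
      then have "poly_of_coords c = a \<star> g"
        using ne(3) by (rule skew_mult_cancel_right)
      then show "poly_of_coords c \<in> left_ideal \<theta> g"
        by (simp add: left_ideal_def)
    qed (auto simp: left_ideal_def skew_assoc simp flip: assms(3))
    finally show ?thesis
      by (simp add: poly_of_coords_eq_0_iff dim)
  qed
  moreover have "F \<in> left_ideal \<theta> g"
    using assms(2) by (simp add: left_ideal_def)
  ultimately show ?thesis
    by (auto simp: is_control_mat_def cyclic_code_eq T_orbit_mat_def)
qed

end

section \<open>Finite fields: characteristic and the identity \<open>x ^ q = x\<close>\<close>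

lemma of_nat_CARD_eq_0: "of_nat CARD('a::{ring_1,finite}) = (0 :: 'a)"
proof -
  \<comment> \<open>Translation by 1 permutes the ring, so the sum of all elements is unchanged and
    the added ones must sum to 0.\<close>
  have "bij (\<lambda>x :: 'a. x + 1)"
    by (rule bij_betw_byWitness[where f' = "\<lambda>x. x - 1"]) auto
  then have "(\<Sum>x\<in>UNIV. x + 1) = (\<Sum>x\<in>UNIV. x :: 'a)"
    by (rule sum.reindex_bij_betw)
  then show ?thesis
    by (simp add: sum.distrib)
qed

text \<open>The characteristic is a prime dividing \<open>p ^ n\<close>. Knowing it makes the
  \<open>p\<close>-th power map additive.\<close>

lemma CHAR_eq_of_CARD:
  assumes "CARD('a::{field,finite}) = p ^ n" "prime p"
  shows "CHAR('a) = p"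
proof -
  have "prime CHAR('a)"
    by (intro prime_CHAR_semidom finite_imp_CHAR_pos) simp
  moreover have "CHAR('a) dvd p ^ n"
    using of_nat_CARD_eq_0[where ?'a = 'a] by (simp only: assms(1) of_nat_eq_0_iff_char_dvd)
  ultimately show ?thesis
    using assms(2) prime_dvd_power primes_dvd_imp_eq by blast
qed

text \<open>Multiplication by a nonzero \<open>x\<close> permutes the nonzero elements; comparing
  their products gives \<open>x ^ (q - 1) = 1\<close>.\<close>

lemma field_power_CARD_eq_same:
  fixes x :: "'a::{field,finite}"
  shows "x ^ CARD('a) = x"
proof (cases "x = 0")
  case False
  have "bij_betw ((*) x) (UNIV - {0}) (UNIV - {0})"
    by (rule bij_betw_byWitness[where f' = "\<lambda>y. y / x"]) (use False in auto)
  then have "(\<Prod>y\<in>UNIV - {0}. x * y) = \<Prod>(UNIV - {0})"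
    by (rule prod.reindex_bij_betw)
  then have "x ^ (CARD('a) - 1) = 1"
    by (simp add: prod.distrib)
  then show ?thesis
    using power_minus_mult[of "CARD('a)" x] by simp
qed simp

section \<open>The Frobenius case: cofactors of \<open>g\<close> in \<open>G\<close> and
  \<open>G\<^sub>0\<close>\<close>

theorem corollary4p6:
  fixes p n r :: nat and \<theta> :: "'a::{field,finite} \<Rightarrow> 'a" and G\<^sub>0 G g h :: "'a poly"
  assumes "prime p" and "n \<ge> 1" and "CARD('a) = p ^ n"
    and "\<theta> = (\<lambda>a. a ^ p)"
    and "G\<^sub>0 = monom 1 ((p - 1) * n) - 1"
    and "G = monom 1 ((p - 1) * n + 1) - monom 1 1"
    and "W_polynomial \<theta> g" and "degree g = r" and "r \<ge> 1"
    and "lead_coeff h = 1" and "G = skew_mult \<theta> h g"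
  shows
    "(\<exists>l. 1 \<le> l \<and> l \<le> n \<and> (map_poly \<theta> ^^ l) g = g) \<and>
     (\<forall>l. 1 \<le> l \<and> l \<le> n \<and> (map_poly \<theta> ^^ l) g = g \<longrightarrow>
        G = skew_mult \<theta> h g \<and>
        G = skew_mult \<theta> g ((map_poly \<theta> ^^ (l - 1)) h) \<and>
        is_control_mat ((p - 1) * n + 1)
          (T_orbit_mat \<theta> G
             ((map_vec \<theta> ^^ (l - 1)) (coord_vec ((p - 1) * n + 1) h)) ((p - 1) * n + 1))
          (cyclic_code \<theta> g G)) \<and>
     (coeff g 0 \<noteq> 0 \<longrightarrow>
        (\<exists>h'. G\<^sub>0 = skew_mult \<theta> h' g \<and> G\<^sub>0 = skew_mult \<theta> g h' \<and>
           is_control_mat ((p - 1) * n)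
             (T_orbit_mat \<theta> G\<^sub>0 (coord_vec ((p - 1) * n) h') ((p - 1) * n))
             (cyclic_code \<theta> g G\<^sub>0)))"
proof -
  have CHAR: "CHAR('a) = p"
    using assms(3,1) by (rule CHAR_eq_of_CARD)
  interpret field_endomorphism \<theta>
  proof
    show "\<theta> (x + y) = \<theta> x + \<theta> y" for x y
      unfolding assms(4) by (rule freshmans_dream) (simp_all add: CHAR assms(1))
  qed (simp_all add: assms(4) power_mult_distrib)

  have funpow_p: "(\<theta> ^^ k) x = x ^ (p ^ k)" for k x
    by (induction k) (simp_all add: assms(4) mult.commute flip: power_mult)
  have "(\<theta> ^^ n) = id"
    using field_power_CARD_eq_same[where ?'a = 'a] by (auto simp: funpow_p assms(3))
  then have map_n: "(map_poly \<theta> ^^ n) = id"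
    by (intro ext poly_eqI) (simp add: coeff_map_poly_funpow)
  have map_Nn: "(map_poly \<theta> ^^ ((p - 1) * n)) = id"
    by (subst mult.commute) (simp only: funpow_mult[symmetric] map_n id_funpow)

  define N where "N = (p - 1) * n"
  have N: "N > 0"
    using prime_gt_1_nat[OF assms(1)] assms(2) by (simp add: N_def)
  have G0: "G\<^sub>0 = monom 1 N - 1" and G: "G = monom 1 (Suc N) - monom 1 1"
    by (simp_all add: N_def assms(5,6))
  have deg_G0: "degree G\<^sub>0 = N" and deg_G: "degree G = Suc N"
    using N by (auto simp: G0 G intro!: antisym degree_le le_degree)
  have lc_G0: "lead_coeff G\<^sub>0 = 1" and lc_G: "lead_coeff G = 1"
    using N unfolding deg_G0 deg_G by (simp_all add: G0 G)
  have "G \<noteq> 0"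
    using lc_G by auto
  then have ne: "g \<noteq> 0"
    using assms(11) by (auto simp: skew_zero)
  have deg_g: "degree g > 0"
    using assms(8,9) by simp

  \<comment> \<open>The coefficients of \<open>G\<close> are 0 and differences of 0 and 1, all fixed
    by \<open>\<theta>\<close>.\<close>
  have map_G: "(map_poly \<theta> ^^ k) G = G" for k
  proof (rule poly_eqI)
    interpret pow: field_endomorphism "\<theta> ^^ k"
      by (rule field_endomorphism_funpow)
    show "coeff ((map_poly \<theta> ^^ k) G) i = coeff G i" for i
      by (simp add: coeff_map_poly_funpow G pow.endo_minus pow.endo_0 pow.endo_1)
  qed
  \<comment> \<open>\<open>N\<close> is a multiple of \<open>n\<close>, so moving the power
    \<open>Suc N\<close> of \<open>t\<close> past \<open>f\<close> twists it just as moving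
    \<open>t\<close> does: once.\<close>
  have G_comm: "G \<star> f = map_poly \<theta> f \<star> G" for f
    unfolding G skew_minus_left skew_minus_right monom_1_skew_mult
    using fun_cong[OF map_Nn[folded N_def]] by simp
  have G0_comm: "G\<^sub>0 \<star> f = f \<star> G\<^sub>0" for f
    unfolding G0 skew_minus_left skew_minus_right monom_1_skew_mult skew_one
    using fun_cong[OF map_Nn[folded N_def]] by simp

  have ex_l: "\<exists>l. 1 \<le> l \<and> l \<le> n \<and> (map_poly \<theta> ^^ l) g = g"
    using assms(2) map_n by (intro exI[of _ n]) simp

  have G_eq: "G = g \<star> (map_poly \<theta> ^^ (l - 1)) h" if l: "1 \<le> l" "(map_poly \<theta> ^^ l) g = g" for l
  proof -
    let ?m = "map_poly \<theta> ^^ (l - 1)"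
    \<comment> \<open>Here \<open>1 \<le> l\<close> matters: \<open>l - 1\<close> is not truncated,
      and one more twist completes the \<open>l\<close> twists that fix \<open>g\<close>.\<close>
    have "map_poly \<theta> (?m g) = g"
      using l by (cases l) simp_all
    then have comm: "G \<star> ?m g = g \<star> G"
      by (simp add: G_comm)
    have "?m h \<star> ?m g = G"
      using map_G[of "l - 1"] by (simp add: assms(11) map_poly_funpow_skew_mult)
    then have "G \<star> ?m g = g \<star> ?m h \<star> ?m g"
      using comm by (simp add: skew_assoc)
    moreover have "?m g \<noteq> 0"
      using ne \<open>map_poly \<theta> (?m g) = g\<close> by auto
    ultimately show ?thesis
      by (rule skew_mult_cancel_right)
  qed

  have b: "is_control_mat (Suc N)
      (T_orbit_mat \<theta> G ((map_vec \<theta> ^^ (l - 1)) (coord_vec (Suc N) h)) (Suc N)) (cyclic_code \<theta> g G)"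
    if l: "1 \<le> l" "(map_poly \<theta> ^^ l) g = g" for l
  proof -
    \<comment> \<open>Twisting commutes with taking coordinates, so the first row is the vector of
      the right cofactor found in \<open>G_eq\<close>.\<close>
    have "(map_vec \<theta> ^^ k) (coord_vec M h) = coord_vec M ((map_poly \<theta> ^^ k) h)" for k M
      by (induction k) (auto simp: coord_vec_def coeff_map_poly endo_0)
    then show ?thesis
      using control_mat_cyclic_code[OF lc_G assms(11) G_eq[OF l] deg_g] by (simp add: deg_G)
  qed

  have c: "\<exists>h'. G\<^sub>0 = h' \<star> g \<and> G\<^sub>0 = g \<star> h' \<and>
      is_control_mat N (T_orbit_mat \<theta> G\<^sub>0 (coord_vec N h') N) (cyclic_code \<theta> g G\<^sub>0)"
    if g0: "coeff g 0 \<noteq> 0"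
  proof -
    \<comment> \<open>Constant terms multiply without a twist. As \<open>G\<close> has constant term
      0 and \<open>g\<close> does not, \<open>t\<close> divides \<open>h\<close>.\<close>
    have "coeff h 0 * coeff g 0 = coeff G 0"
      by (simp add: assms(11) coeff_skew_mult)
    then have "coeff h 0 = 0"
      using g0 N by (simp add: G)
    \<comment> \<open>Dropping the constant term writes \<open>h\<close> with \<open>t\<close> on
      the right. Bringing \<open>t\<close> to the left needs the inverse of \<open>\<theta>\<close>
      on coefficients, which is its iterate of order \<open>n - 1\<close>.\<close>
    define u where "u = (map_poly \<theta> ^^ (n - 1)) (poly_shift 1 h)"
    have "map_poly \<theta> u = poly_shift 1 h"
      using fun_cong[OF map_n, of "poly_shift 1 h"] assms(2) by (cases n) (simp_all add: u_def)
    then have h: "h = monom 1 1 \<star> u"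
      using \<open>coeff h 0 = 0\<close> unfolding monom_1_skew_mult
      by (intro poly_eqI) (auto simp: coeff_skew_mult_monom_1 coeff_poly_shift not_less_eq_eq)
    \<comment> \<open>Both \<open>G\<^sub>0\<close> and \<open>u \<star> g\<close> become
      \<open>G\<close> when multiplied by \<open>t\<close> on the left, so cancelling
      \<open>t\<close> identifies them.\<close>
    have "monom 1 1 \<star> G\<^sub>0 = G"
      by (simp add: G G0 skew_minus_right skew_mult_monom endo_0 endo_1 skew_one)
    also have "G = monom 1 1 \<star> (u \<star> g)"
      by (simp add: assms(11) h skew_assoc)
    finally have left: "G\<^sub>0 = u \<star> g"
      by (rule skew_mult_cancel_left) simp
    \<comment> \<open>Centrality of \<open>G\<^sub>0\<close> turns the left cofactor
      \<open>u\<close> into a right one: \<open>G\<^sub>0 \<star> g = g \<star> G\<^sub>0\<close>,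
      then \<open>g\<close> is cancelled.\<close>
    with G0_comm[of g] have "G\<^sub>0 \<star> g = g \<star> u \<star> g"
      by (simp add: skew_assoc)
    then have right: "G\<^sub>0 = g \<star> u"
      using ne by (rule skew_mult_cancel_right)
    from left right control_mat_cyclic_code[OF lc_G0 left right deg_g] show ?thesis
      unfolding deg_G0 by blast
  qed

  show ?thesis
    unfolding N_def[symmetric] Suc_eq_plus1[symmetric]
    using ex_l assms(11) G_eq b c by blast
qed

end
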